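(* Let $\kappa$ be an infinite cardinal. Then $2^{\aleph_0}\leq\kappa^+$ if and only if the set of all transcendental reals is the union of $\kappa$-many algebraically independent sets.
   Context: $\kappa^+$ denotes the cardinal successor of $\kappa$. A real is transcendental if it is not algebraic over $\mathbb{Q}$. A set $S\subseteq\mathbb{R}$ is algebraically independent (over $\mathbb{Q}$) if there are no pairwise distinct $x_0,\dots,x_n\in S$ such that $x_n$ is algebraic over the field $\mathbb{Q}(x_0,\dots,x_{n-1})$. *)

theory Defs
  imports Complex_Main "HOL-Algebra.Generated_Fields" "HOL-Algebra.Algebraic_Closure_Type"
begin

unbundle cardinal_syntax

text \<open>The field of real numbers as a record, so that the field-extension theory of HOL-Algebra
  applies to it.\<close>

abbreviation real_field :: "real ring"
  where "real_field \<equiv> ring_of_type_algebra"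

abbreviation algebraic_over :: "real set \<Rightarrow> real \<Rightarrow> bool"
  where "algebraic_over K x \<equiv> (ring.algebraic real_field over K) x"

definition transcendental_reals :: "real set"
  where "transcendental_reals = {x. \<not> algebraic_over \<rat> x}"

text \<open>The field \<open>\<rat>(x\<^sub>0, \<dots>, x\<^sub>n\<^sub>-\<^sub>1)\<close> is \<open>generate_field real_field (x ` {..<n})\<close>: every
  subfield of the reals contains the rationals, so they need not be listed as generators.
  For \<open>n = 0\<close> this field is \<open>\<rat>\<close> itself, hence an algebraically independent set has only
  transcendental elements.\<close>

definition algebraically_independent :: "real set \<Rightarrow> bool"
  where "algebraically_independent S \<longleftrightarrow>
    \<not> (\<exists>(n::nat) (x::nat \<Rightarrow> real). inj_on x {..n} \<and> x ` {..n} \<subseteq> S \<and>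
         algebraic_over (generate_field real_field (x ` {..<n})) (x n))"

end

theory Submission
  imports Defs "HOL-Analysis.Abstract_Topology_2"
begin

text \<open>
  Both directions compare the number of reals with \<open>\<kappa>\<^sup>+\<close> through colourings of the transcendental
  reals with \<open>\<kappa>\<close> colours; the colour classes are the sets of the cover.

  If the continuum is at most \<open>\<kappa>\<^sup>+\<close>, the reals are the union of a well-ordered increasing chain of relatively
  algebraically closed subfields of size at most \<open>\<kappa>\<close>, obtained by closing the initial segments of a
  well-order of type at most \<open>\<kappa>\<^sup>+\<close> (\<open>card_algebraic_closure_of\<close> bounds their size). A colouring that is
  injective on each layer of the chain has independent colour classes: among finitely many
  transcendental reals from different layers, the one in the highest layer is not algebraic over the others. The
  exchange property of algebraic dependence (\<open>algebraic_exchange\<close>) turns this into independence of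
  the class (\<open>algebraically_independentI\<close>).

  If the continuum exceeds \<open>\<kappa>\<^sup>+\<close>, then for any colouring with \<open>\<kappa>\<close> colours the pigeonhole principle, applied once with
  \<open>\<kappa>\<^sup>+\<close> summands against \<open>\<kappa>\<close> colours and once with more than \<open>\<kappa>\<^sup>+\<close> summands against \<open>\<kappa>\<^sup>+\<close> outcomes,
  produces a monochromatic rectangle of sums \<open>x\<^sub>i + y\<^sub>j\<close>. Its corners satisfy a linear relation
  (\<open>no_sum_rectangle\<close>), so the colour class is dependent.
\<close>

section \<open>The record field of real numbers\<close>

lemma real_field_simps [simp]:
  "carrier real_field = UNIV" "\<zero>\<^bsub>real_field\<^esub> = 0" "\<one>\<^bsub>real_field\<^esub> = 1"
  "x \<oplus>\<^bsub>real_field\<^esub> y = x + y" "x \<otimes>\<^bsub>real_field\<^esub> y = x * y"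
  by (simp_all add: ring_of_type_algebra_def)

lemma field_real_field: "field real_field"
  by (rule field_from_type_algebra)

lemma domain_real_field: "domain real_field"
  using field_real_field by (rule field.axioms)

lemma ring_real_field: "ring real_field"
  by (rule ring_from_type_algebra)

lemma real_field_uminus [simp]: "\<ominus>\<^bsub>real_field\<^esub> x = - x"
proof -
  interpret field real_field by (rule field_real_field)
  show ?thesis using minus_equality[of "-x" x] by simp
qed

lemma real_field_inverse [simp]: "x \<noteq> 0 \<Longrightarrow> inv\<^bsub>real_field\<^esub> x = inverse x"
proof -
  interpret field real_field by (rule field_real_field)
  show "x \<noteq> 0 \<Longrightarrow> inv\<^bsub>real_field\<^esub> x = inverse x" using comm_inv_char[of x "inverse x"] by simp
qed

lemma real_field_power [simp]: "x [^]\<^bsub>real_field\<^esub> (n::nat) = x ^ n"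
proof -
  interpret field real_field by (rule field_real_field)
  show ?thesis by (induction n) auto
qed

lemma subfield_real_iff:
  "subfield K real_field \<longleftrightarrow> 0 \<in> K \<and> 1 \<in> K \<and> (\<forall>x\<in>K. - x \<in> K) \<and> (\<forall>x\<in>K. inverse x \<in> K) \<and>
     (\<forall>x\<in>K. \<forall>y\<in>K. x + y \<in> K) \<and> (\<forall>x\<in>K. \<forall>y\<in>K. x * y \<in> K)"
  (is "_ \<longleftrightarrow> ?rhs")
proof
  interpret field real_field by (rule field_real_field)
  assume K: "subfield K real_field"
  have "inverse x \<in> K" if "x \<in> K" for x
    using subfield_m_inv(1)[OF K, of x] subringE(2)[OF subfieldE(1)[OF K]] that
    by (cases "x = 0") auto
  then show ?rhs
    using subringE[OF subfieldE(1)[OF K]] by auto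
next
  interpret field real_field by (rule field_real_field)
  assume ?rhs
  then show "subfield K real_field"
    by (intro subfieldI' subringI) auto
qed

definition polys_over :: "real set \<Rightarrow> real poly set"
  where "polys_over K = {p. \<forall>i. poly.coeff p i \<in> K}"

text \<open>Polynomials over a ring record list coefficients from the leading one downwards, the polynomial
  type from the constant one upwards; hence the reversal.\<close>

lemma eval_eq_poly: "ring.eval real_field p x = poly (Poly (rev p)) x"
proof -
  interpret field real_field by (rule field_real_field)
  show ?thesis by (induction p) (auto simp: Poly_append poly_monom mult.commute)
qed

text \<open>Bridge from the polynomials over a ring record, which are normalized coefficient lists, to the
  type of real polynomials, where products, root counts and coefficient extraction
  are available.\<close>

lemma algebraic_over_iff:
  assumes K: "subfield K real_field"
  shows "algebraic_over K x \<longleftrightarrow> (\<exists>p\<in>polys_over K. p \<noteq> 0 \<and> poly p x = 0)"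
proof
  interpret field real_field by (rule field_real_field)
  assume "algebraic_over K x"
  then obtain p where p: "polynomial\<^bsub>real_field\<^esub> K p" "p \<noteq> []" "eval p x = 0"
    using algebraicE[OF subfieldE(1)[OF K]] by (auto simp: univ_poly_carrier)
  have "Poly (rev p) \<in> polys_over K"
    using polynomial_incl[OF p(1)] subfield_real_iff[THEN iffD1, OF K]
    by (auto simp: polys_over_def nth_default_def rev_nth)
  moreover have "Poly (rev p) \<noteq> 0"
  proof
    assume "Poly (rev p) = 0"
    then obtain n where n: "p = replicate n 0"
      by (metis Poly_eq_0 rev_replicate rev_rev_ident)
    moreover have "hd p \<noteq> 0" using p by (cases p) (auto simp: polynomial_def)
    ultimately show False using p(2) by (cases n) auto
  qed
  ultimately show "\<exists>p\<in>polys_over K. p \<noteq> 0 \<and> poly p x = 0"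
    using p(3) by (auto simp: eval_eq_poly)
next
  interpret field real_field by (rule field_real_field)
  assume "\<exists>p\<in>polys_over K. p \<noteq> 0 \<and> poly p x = 0"
  then obtain p where p: "p \<in> polys_over K" "p \<noteq> 0" "poly p x = 0" by blast
  define q where "q = rev (coeffs p)"
  have "q \<noteq> []" "hd q \<noteq> 0" 
    using p(2) by (auto simp: q_def hd_rev last_coeffs_eq_coeff_degree)
  moreover have "set q \<subseteq> K"
    using p(1) by (auto simp: q_def polys_over_def coeffs_def)
  ultimately have "polynomial\<^bsub>real_field\<^esub> K q"
    by (auto simp: polynomial_def)
  moreover have "eval q x = 0" using p(3) by (simp add: eval_eq_poly q_def)
  ultimately show "algebraic_over K x"
    using algebraicI[of q K x] \<open>q \<noteq> []\<close> by (simp add: univ_poly_carrier)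
qed

lemma subfield_generate_field: "subfield (generate_field real_field S) real_field"
  using field.generate_field_is_subfield[OF field_real_field] by simp

lemma generate_field_subset: 
  "subfield K real_field \<Longrightarrow> S \<subseteq> K \<Longrightarrow> generate_field real_field S \<subseteq> K"
  using field.generate_field_min_subfield1[OF field_real_field] by simp

lemma algebraic_over_mono: "K \<subseteq> L \<Longrightarrow> algebraic_over K x \<Longrightarrow> algebraic_over L x"
  using ring.algebraic_mono[OF ring_real_field] .

text \<open>The rationals enter transcendence as \<open>\<rat>\<close> and independence as the field generated by the
  empty set; both are the prime field.\<close>

lemma Rats_eq_generate_field: "\<rat> = generate_field real_field {}"
proof
  show "generate_field real_field {} \<subseteq> \<rat>"
    by (rule generate_field_subset) (auto simp: subfield_real_iff)
next
  note K = subfield_generate_field[of "{}", unfolded subfield_real_iff]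
  have nat: "real n \<in> generate_field real_field {}" for n
    using K by (induction n) auto
  have int: "real_of_int n \<in> generate_field real_field {}" for n
    using nat K by (cases n rule: int_cases2) auto
  show "\<rat> \<subseteq> generate_field real_field {}"
  proof
    fix x :: real assume "x \<in> \<rat>"
    then obtain a b where "x = real_of_int a * inverse (real_of_int b)"
      by (metis Rats_cases' divide_inverse)
    then show "x \<in> generate_field real_field {}" using K int by simp
  qed
qed


section \<open>The exchange property and a criterion for independence\<close>

context
  fixes K assumes K: "subfield K real_field"
begin

lemma sum_in_subfield: "(\<And>i. i \<in> I \<Longrightarrow> f i \<in> K) \<Longrightarrow> sum f I \<in> K"
  using K unfolding subfield_real_iff by (induction I rule: infinite_finite_induct) auto

lemma power_in_subfield: "x \<in> K \<Longrightarrow> x ^ n \<in> K"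
  using K unfolding subfield_real_iff by (induction n) auto

lemma polys_over_mult: "p \<in> polys_over K \<Longrightarrow> q \<in> polys_over K \<Longrightarrow> p * q \<in> polys_over K"
  using K by (auto simp: polys_over_def subfield_real_iff coeff_mult intro!: sum_in_subfield)

lemma polys_over_add: "p \<in> polys_over K \<Longrightarrow> q \<in> polys_over K \<Longrightarrow> p + q \<in> polys_over K"
  using K by (auto simp: polys_over_def subfield_real_iff)

lemma polys_over_uminus: "p \<in> polys_over K \<Longrightarrow> - p \<in> polys_over K"
  using K by (auto simp: polys_over_def subfield_real_iff)

lemma polys_over_const: "c \<in> K \<Longrightarrow> [:c:] \<in> polys_over K"
  using K by (auto simp: polys_over_def subfield_real_iff coeff_pCons split: nat.splits)

lemma polys_over_X: "[:0, 1:] \<in> polys_over K"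
  using K by (auto simp: polys_over_def subfield_real_iff coeff_pCons split: nat.splits)

lemma polys_over_prod: "(\<And>i. i \<in> I \<Longrightarrow> f i \<in> polys_over K) \<Longrightarrow> prod f I \<in> polys_over K"
  using polys_over_mult polys_over_const[of 1] K 
  by (induction I rule: infinite_finite_induct) (auto simp: subfield_real_iff one_pCons)

text \<open>The fractions \<open>u(y) / v(y)\<close> already form a subfield containing \<open>K\<close> and \<open>y\<close>. Writing elements of
  \<open>K(y)\<close> this way is what allows the denominators to be cleared in the exchange argument.\<close>

lemma simple_extension_fractions:
  assumes "a \<in> generate_field real_field (insert y K)"
  shows "\<exists>u\<in>polys_over K. \<exists>v\<in>polys_over K. poly v y \<noteq> 0 \<and> a = poly u y / poly v y"
proof -
  define L where "L = {poly u y / poly v y |u v. u \<in> polys_over K \<and> v \<in> polys_over K \<and> poly v y \<noteq> 0}"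
  have LI: "poly u y / poly v y \<in> L" if "u \<in> polys_over K" "v \<in> polys_over K" "poly v y \<noteq> 0" for u v
    using that unfolding L_def by blast
  have cst: "c \<in> L" if "c \<in> K" for c
    using LI[of "[:c:]" "[:1:]"] polys_over_const that K by (auto simp: subfield_real_iff)
  have y: "y \<in> L"
    using LI[of "[:0,1:]" "[:1:]"] polys_over_const polys_over_X K by (auto simp: subfield_real_iff)
  have sf: "subfield L real_field"
    unfolding subfield_real_iff
  proof (intro conjI ballI)
    show "0 \<in> L" "1 \<in> L" using cst K by (auto simp: subfield_real_iff)
  next
    fix a assume "a \<in> L"
    then obtain u v where a: "u \<in> polys_over K" "v \<in> polys_over K" "poly v y \<noteq> 0" "a = poly u y / poly v y"
      unfolding L_def by blast
    show "- a \<in> L" using LI[of "-u" v] a polys_over_uminus by simp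
    show "inverse a \<in> L" using LI[of v u] a \<open>a \<in> L\<close> by (cases "poly u y = 0") auto
    fix b assume "b \<in> L"
    then obtain s t where b: "s \<in> polys_over K" "t \<in> polys_over K" "poly t y \<noteq> 0" "b = poly s y / poly t y"
      unfolding L_def by blast
    show "a + b \<in> L" using LI[of "u * t + s * v" "v * t"] a b polys_over_add polys_over_mult
      by (simp add: add_frac_eq)
    show "a * b \<in> L" using LI[of "u * s" "v * t"] a b polys_over_add polys_over_mult
      by simp
  qed
  have "generate_field real_field (insert y K) \<subseteq> L"
    using generate_field_subset[OF sf] cst y by blast
  then show ?thesis using assms unfolding L_def by blast
qed

end

text \<open>After clearing denominators, an algebraic equation for \<open>x\<close> over \<open>K(y)\<close> reads
  \<open>\<Sum>\<^sub>j w\<^sub>j(y) x\<^sup>j = 0\<close> with polynomials \<open>w\<^sub>j\<close> over \<open>K\<close>. Reading the same double sum as a polynomial in \<open>y\<close>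
  gives an equation for \<open>y\<close> over \<open>K(x)\<close>. Its coefficients are polynomials over \<open>K\<close> evaluated at \<open>x\<close>; if
  they all vanished, then, \<open>x\<close> being transcendental over \<open>K\<close>, every coefficient of every \<open>w\<^sub>j\<close> would
  vanish, and with them the original equation.\<close>

lemma algebraic_exchange_subfield:
  assumes K: "subfield K real_field"
    and x: "algebraic_over (generate_field real_field (insert y K)) x" "\<not> algebraic_over K x"
  shows "algebraic_over (generate_field real_field (insert x K)) y"
proof -
  define L where "L = generate_field real_field (insert x K)"
  have L: "subfield L real_field" unfolding L_def by (rule subfield_generate_field)
  have KL: "K \<subseteq> L" "x \<in> L" unfolding L_def by (auto intro: generate_field.incl)
  obtain p where p: "p \<in> polys_over (generate_field real_field (insert y K))" "p \<noteq> 0" "poly p x = 0"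
    using x(1) algebraic_over_iff[OF subfield_generate_field] by blast
  let ?n = "Polynomial.degree p"
  have "\<forall>j. \<exists>u v. u \<in> polys_over K \<and> v \<in> polys_over K \<and> poly v y \<noteq> 0 \<and> 
      poly.coeff p j = poly u y / poly v y"
    using p(1) simple_extension_fractions[OF K] unfolding polys_over_def[of "generate_field _ _"] by fast
  then obtain u v where uv: "\<And>j. u j \<in> polys_over K" "\<And>j. v j \<in> polys_over K" 
      "\<And>j. poly (v j) y \<noteq> 0" "\<And>j. poly.coeff p j = poly (u j) y / poly (v j) y"
    by metis
  \<comment> \<open>The value at \<open>y\<close> is the coefficient of \<open>x\<^sup>j\<close> after multiplication by the common denominator \<open>\<Prod>\<^sub>k v\<^sub>k(y)\<close>.\<close>
  define w where "w j = u j * prod v ({..?n} - {j})" for j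
  have w: "w j \<in> polys_over K" for j
    unfolding w_def by (intro polys_over_mult[OF K] polys_over_prod[OF K] uv)
  define d where "d = poly (prod v {..?n}) y"
  have d: "d \<noteq> 0" using uv(3) by (simp add: d_def poly_prod)
  have wy: "poly (w j) y = d * poly.coeff p j" if "j \<le> ?n" for j
    using that prod.remove[of "{..?n}" j v] uv(3)[of j] by (simp add: w_def d_def uv(4))
  \<comment> \<open>The double sum, now sorted by powers of \<open>y\<close>.\<close>
  define q where "q = (\<Sum>j\<le>?n. smult (x ^ j) (w j))"
  have "x ^ j * poly.coeff (w j) i \<in> L" for i j
    using w[of j] KL(1) power_in_subfield[OF L KL(2), of j] L
    by (simp add: polys_over_def subfield_real_iff subset_iff)
  then have "q \<in> polys_over L"
    by (auto simp: q_def polys_over_def coeff_sum intro!: sum_in_subfield[OF L])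
  moreover have "poly q y = 0"
  proof -
    have "poly q y = (\<Sum>j\<le>?n. d * (poly.coeff p j * x ^ j))"
      by (simp add: q_def poly_sum wy mult_ac)
    also have "\<dots> = d * poly p x" by (simp add: sum_distrib_left poly_altdef)
    finally show ?thesis using p(3) by simp
  qed
  moreover have "q \<noteq> 0"
  proof
    assume "q = 0"
    have zero: "poly.coeff (w j) i = 0" if "j \<le> ?n" for i j
    proof -
      \<comment> \<open>The coefficient of \<open>y\<^sup>i\<close> in \<open>q\<close> is the value at \<open>x\<close> of this polynomial over \<open>K\<close>.\<close>
      define r where "r = (\<Sum>j\<le>?n. Polynomial.monom (poly.coeff (w j) i) j)"
      have r: "poly.coeff r k = (if k \<le> ?n then poly.coeff (w k) i else 0)" for k
        by (simp add: r_def coeff_sum)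
      have "r \<in> polys_over K" using w K by (auto simp: r polys_over_def subfield_real_iff)
      moreover have "poly r x = poly.coeff q i"
        by (simp add: r_def q_def poly_sum poly_monom coeff_sum mult.commute)
      ultimately have "r = 0" using x(2) algebraic_over_iff[OF K] \<open>q = 0\<close> by auto
      then show ?thesis using r[of j] that by simp
    qed
    have "w ?n = 0" using zero[of ?n] by (intro poly_eqI) simp
    then have "poly.coeff p ?n = 0" using wy[of ?n] d by simp
    then show False using p(2) by simp
  qed
  ultimately have "algebraic_over L y"
    using algebraic_over_iff[OF L] by blast
  then show ?thesis by (simp only: L_def)
qed

lemma generate_field_insert_generate_field:
  "generate_field real_field (insert y (generate_field real_field F)) =
   generate_field real_field (insert y F)"
proof
  have "generate_field real_field F \<subseteq> generate_field real_field (insert y F)"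
    by (rule generate_field_subset[OF subfield_generate_field]) (auto intro: generate_field.incl)
  then show "generate_field real_field (insert y (generate_field real_field F)) \<subseteq> 
     generate_field real_field (insert y F)"
    by (intro generate_field_subset[OF subfield_generate_field]) (auto intro: generate_field.incl)
  show "generate_field real_field (insert y F) \<subseteq>
      generate_field real_field (insert y (generate_field real_field F))"
    by (rule generate_field_subset[OF subfield_generate_field]) (auto intro: generate_field.incl)
qed

lemma algebraic_exchange:
  assumes "algebraic_over (generate_field real_field (insert y F)) x"
    and "\<not> algebraic_over (generate_field real_field F) x"
  shows "algebraic_over (generate_field real_field (insert x F)) y"
  using algebraic_exchange_subfield[OF subfield_generate_field, of y F x] assms
  unfolding generate_field_insert_generate_field by blast

text \<open>Dependence as defined singles out the last element \<open>x\<^sub>n\<close> of a sequence. The exchange property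
  makes all members of a minimal dependence equivalent, so that it suffices to find one element of
  each nonempty finite set, in whatever position, that is transcendental over the others.\<close>

lemma algebraically_independentI:
  assumes *: "\<And>G. finite G \<Longrightarrow> G \<noteq> {} \<Longrightarrow> G \<subseteq> S \<Longrightarrow>
     \<exists>y\<in>G. \<not> algebraic_over (generate_field real_field (G - {y})) y"
  shows "algebraically_independent S"
  unfolding algebraically_independent_def
proof
  assume "\<exists>(n::nat) (x::nat \<Rightarrow> real). inj_on x {..n} \<and> x ` {..n} \<subseteq> S \<and> 
      algebraic_over (generate_field real_field (x ` {..<n})) (x n)"
  then obtain n :: nat and x where x: "inj_on x {..n}" "x ` {..n} \<subseteq> S" 
    "algebraic_over (generate_field real_field (x ` {..<n})) (x n)" by blast
  let ?alg = "\<lambda>F. algebraic_over (generate_field real_field F) (x n)"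
  \<comment> \<open>Minimality makes every element of \<open>F\<close> indispensable, so it can be exchanged with \<open>x\<^sub>n\<close>.\<close>
  obtain F where F: "F \<subseteq> x ` {..<n}" "?alg F" and min: "\<And>F'. F' \<subset> F \<Longrightarrow> \<not> ?alg F'"
  proof -
    have "finite (x ` {..<n})" by simp
    then obtain F where "F \<subseteq> x ` {..<n}" "?alg F" "\<And>F'. F' \<subseteq> F \<Longrightarrow> ?alg F' \<Longrightarrow> F' = F"
      using finite_has_minimal2[of "{F. F \<subseteq> x ` {..<n} \<and> ?alg F}" "x ` {..<n}"] x(3)
      by (auto simp: finite_Collect_subsets) (metis subset_trans)
    then show thesis using that by blast
  qed
  have notin: "x n \<notin> F"
  proof
    assume "x n \<in> F"
    then obtain i where "i < n" "x n = x i" using F(1) by blast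
    then show False using inj_onD[OF x(1), of n i] by simp
  qed
  have "finite F" using F(1) by (rule finite_subset) simp
  moreover have "x n \<in> S" "F \<subseteq> S" using F(1) x(2) by (auto simp: image_subset_iff)
  ultimately have "\<exists>y\<in>insert (x n) F.
      \<not> algebraic_over (generate_field real_field (insert (x n) F - {y})) y"
    by (intro *) auto
  then obtain y where y: "y \<in> insert (x n) F"
      "\<not> algebraic_over (generate_field real_field (insert (x n) F - {y})) y" ..
  have "y \<noteq> x n"
  proof
    assume "y = x n"
    then have "insert (x n) F - {y} = F" using notin by auto
    then show False using y(2) F(2) \<open>y = x n\<close> by simp
  qed
  then have "y \<in> F" using y(1) by blast
  have "algebraic_over (generate_field real_field (insert (x n) (F - {y}))) y"
  proof (rule algebraic_exchange)
    show "?alg (insert y (F - {y}))" using F(2) \<open>y \<in> F\<close> by (simp add: insert_absorb)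
    show "\<not> ?alg (F - {y})" using min[of "F - {y}"] \<open>y \<in> F\<close> by blast
  qed
  moreover have "insert (x n) (F - {y}) = insert (x n) F - {y}" using \<open>y \<noteq> x n\<close> by blast
  ultimately show False using y(2) by simp
qed

text \<open>Set version of the definition: a finite set is enumerated as \<open>x\<^sub>0, \<dots>, x\<^sub>n\<^sub>-\<^sub>1\<close> and \<open>p\<close> is put in
  place of \<open>x\<^sub>n\<close>.\<close>

lemma algebraically_independentD:
  assumes S: "algebraically_independent S" and F: "finite F" "F \<subseteq> S" and p: "p \<in> S" "p \<notin> F"
  shows "\<not> algebraic_over (generate_field real_field F) p"
proof -
  obtain h where h: "bij_betw h {0..<card F} F" using ex_bij_betw_nat_finite[OF F(1)] by blast
  let ?n = "card F"
  let ?x = "h(?n := p)"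
  have img: "?x ` {..<?n} = F" 
    using h by (auto simp: bij_betw_def lessThan_atLeast0)
  have "inj_on h {..<?n}" using h by (simp add: bij_betw_def lessThan_atLeast0)
  then have "inj_on ?x {..<?n}" by (simp add: inj_on_def)
  then have "inj_on ?x (insert ?n {..<?n})" using img p(2) by simp
  moreover have "?x ` (insert ?n {..<?n}) \<subseteq> S" unfolding image_insert img using F(2) p(1) by simp
  moreover have "insert ?n {..<?n} = {..?n}" by auto
  ultimately have x: "inj_on ?x {..?n}" "?x ` {..?n} \<subseteq> S" by simp_all
  show ?thesis
  proof
    assume "algebraic_over (generate_field real_field F) p"
    then have "algebraic_over (generate_field real_field (?x ` {..<?n})) (?x ?n)"
      unfolding img by simp
    then show False using S x unfolding algebraically_independent_def by blast
  qed
qed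

section \<open>Relatively algebraically closed subfields and their cardinality\<close>

definition relatively_closed :: "real set \<Rightarrow> bool"
  where "relatively_closed T \<longleftrightarrow> subfield T real_field \<and> (\<forall>x. algebraic_over T x \<longrightarrow> x \<in> T)"

text \<open>The algebraic closure of \<open>\<rat>(S)\<close> inside the reals. As an intersection it is visibly monotone
  and closed, which avoids proving that algebraicity is transitive.\<close>

definition algebraic_closure_of :: "real set \<Rightarrow> real set"
  where "algebraic_closure_of S = \<Inter> {T. relatively_closed T \<and> S \<subseteq> T}"

lemma algebraic_closure_of_mono: 
  "S \<subseteq> S' \<Longrightarrow> algebraic_closure_of S \<subseteq> algebraic_closure_of S'"
  unfolding algebraic_closure_of_def by blast

lemma subset_algebraic_closure_of: "S \<subseteq> algebraic_closure_of S"
  unfolding algebraic_closure_of_def by blast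

lemma algebraic_closure_of_minimal:
  "relatively_closed T \<Longrightarrow> S \<subseteq> T \<Longrightarrow> algebraic_closure_of S \<subseteq> T"
  unfolding algebraic_closure_of_def by blast

lemma relatively_closed_algebraic_closure_of: "relatively_closed (algebraic_closure_of S)"
proof -
  have "x \<in> T" if "algebraic_over (algebraic_closure_of S) x" "relatively_closed T" "S \<subseteq> T" for x T
    using algebraic_over_mono[OF algebraic_closure_of_minimal that(1)] that
    unfolding relatively_closed_def by blast
  then have "x \<in> algebraic_closure_of S" if "algebraic_over (algebraic_closure_of S) x" for x
    using that unfolding algebraic_closure_of_def[of S] by blast
  moreover have "subfield (algebraic_closure_of S) real_field"
    unfolding algebraic_closure_of_def relatively_closed_def subfield_real_iff by simp
  ultimately show ?thesis unfolding relatively_closed_def by blast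
qed

lemma algebraic_over_generate_field_in_closed:
  assumes "relatively_closed T" "S \<subseteq> T" "algebraic_over (generate_field real_field S) x"
  shows "x \<in> T"
  using algebraic_over_mono[OF generate_field_subset assms(3), of T] assms
  unfolding relatively_closed_def by blast

lemma finite_ordLeq_Cinfinite:
  assumes "Cinfinite r" "finite A"
  shows "|A| \<le>o r"
proof -
  have "Cfinite |A|"
    using assms(2) by (simp add: cfinite_def Field_card_of card_of_card_order_on)
  then show ?thesis using Cfinite_ordLess_Cinfinite assms(1) ordLess_imp_ordLeq by blast
qed

lemma nat_ordLeq_Cinfinite: "Cinfinite r \<Longrightarrow> |UNIV :: nat set| \<le>o r"
  using natLeq_ordLeq_cinfinite card_of_nat ordIso_ordLeq_trans by blast

lemma image_ordLeq: "|A| \<le>o r \<Longrightarrow> |f ` A| \<le>o r"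
  using card_of_image ordLeq_transitive by blast

lemma Times_ordLeq_Cinfinite:
  "Cinfinite r \<Longrightarrow> |A| \<le>o r \<Longrightarrow> |B| \<le>o r \<Longrightarrow> |A \<times> B| \<le>o r"
  using card_of_Times_ordLeq_infinite_Field[of r A B] by (simp add: cinfinite_def)

text \<open>Polynomials over \<open>K\<close> arise from \<open>0\<close> by finitely many applications of \<^const>\<open>pCons\<close>, so they are a
  countable union of sets of size at most \<open>r\<close>.\<close>

lemma card_polys_over:
  assumes r: "Cinfinite r" and K: "|K| \<le>o r"
  shows "|polys_over K| \<le>o r"
proof -
  define P where "P = rec_nat {0 :: real poly} (\<lambda>_ Q. (\<lambda>(a, p). pCons a p) ` (K \<times> Q))"
  have P [simp]: "P 0 = {0}" "\<And>n. P (Suc n) = (\<lambda>(a, p). pCons a p) ` (K \<times> P n)"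
    by (simp_all add: P_def)
  have "|P n| \<le>o r" for n
  proof (induction n)
    case 0
    show ?case by (simp add: finite_ordLeq_Cinfinite[OF r])
  next
    case (Suc n)
    show ?case unfolding P(2) by (intro image_ordLeq Times_ordLeq_Cinfinite r K Suc.IH)
  qed
  then have "|\<Union>n. P n| \<le>o r"
    using UNION_Cinfinite_bound[OF nat_ordLeq_Cinfinite[OF r] _ r] by blast
  moreover have "\<exists>n. p \<in> P n" if "p \<in> polys_over K" for p
    using that
  proof (induction p)
    case 0
    have "0 \<in> P 0" by simp
    then show ?case by blast
  next
    case (pCons a p)
    have "poly.coeff (pCons a p) i \<in> K" for i
      using pCons.prems by (simp add: polys_over_def)
    from this[of 0] this[of "Suc _"] have "a \<in> K" "p \<in> polys_over K" by (simp_all add: polys_over_def)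
    then obtain n where "p \<in> P n" using pCons.IH by blast
    then have "pCons a p \<in> P (Suc n)" using \<open>a \<in> K\<close> by auto
    then show ?case by blast
  qed
  then have "polys_over K \<subseteq> (\<Union>n. P n)" by blast
  ultimately show ?thesis using card_of_mono1 ordLeq_transitive by blast
qed

definition roots_over :: "real set \<Rightarrow> real set"
  where "roots_over K = (\<Union>p\<in>polys_over K - {0}. {x. poly p x = 0})"

lemma card_roots_over:
  assumes r: "Cinfinite r" and K: "|K| \<le>o r"
  shows "|roots_over K| \<le>o r"
  unfolding roots_over_def
proof (rule UNION_Cinfinite_bound[OF _ _ r])
  show "|polys_over K - {0}| \<le>o r"
    using card_polys_over[OF assms] card_of_mono1[of "polys_over K - {0}" "polys_over K"] 
      ordLeq_transitive by blast
  show "\<forall>p\<in>polys_over K - {0}. |{x. poly p x = 0}| \<le>o r"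
    using finite_ordLeq_Cinfinite[OF r] poly_roots_finite by blast
qed

text \<open>Countably many rounds of adjoining sums, products, negatives, inverses and roots suffice,
  because a polynomial has only finitely many coefficients and these all appear at some finite
  round. Each round preserves the bound \<open>r\<close> on the size.\<close>

lemma exists_relatively_closed_superset:
  assumes r: "Cinfinite r" and S: "|S| \<le>o r"
  shows "\<exists>T. relatively_closed T \<and> S \<subseteq> T \<and> |T| \<le>o r"
proof -
  define step where "step C = C \<union> uminus ` C \<union> inverse ` C \<union> (\<lambda>(a, b). a + b) ` (C \<times> C) \<union>
    (\<lambda>(a, b). a * b) ` (C \<times> C) \<union> roots_over C" for C :: "real set"
  define C where "C n = (step ^^ n) (S \<union> {0, 1})" for n
  have C_Suc: "C (Suc n) = step (C n)" for n by (simp add: C_def)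
  have mono: "m \<le> n \<Longrightarrow> C m \<subseteq> C n" for m n
    by (rule lift_Suc_mono_le) (auto simp: C_Suc step_def)
  have "|C n| \<le>o r" for n
  proof (induction n)
    case 0
    show ?case unfolding C_def funpow_0
      by (intro Un_Cinfinite_bound r S finite_ordLeq_Cinfinite) simp
  next
    case (Suc n)
    show ?case unfolding C_Suc step_def
      by (intro Un_Cinfinite_bound r Suc.IH image_ordLeq Times_ordLeq_Cinfinite card_roots_over)
  qed
  then have card: "|\<Union>n. C n| \<le>o r"
    using UNION_Cinfinite_bound[OF nat_ordLeq_Cinfinite[OF r] _ r] by blast
  define T where "T = (\<Union>n. C n)"
  have stepT: "x \<in> T" if "x \<in> step (C n)" for x n
    using that C_Suc unfolding T_def by blast
  have two: "\<exists>n. a \<in> C n \<and> b \<in> C n" if "a \<in> T" "b \<in> T" for a b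
  proof -
    obtain m n where "a \<in> C m" "b \<in> C n" using \<open>a \<in> T\<close> \<open>b \<in> T\<close> unfolding T_def by blast
    then show ?thesis using mono[of m "max m n"] mono[of n "max m n"] by auto
  qed
  have base: "S \<union> {0, 1} \<subseteq> T" unfolding T_def using C_def[of 0] by auto
  have sf: "subfield T real_field"
    unfolding subfield_real_iff
  proof (intro conjI ballI)
    show "0 \<in> T" "1 \<in> T" using base by auto
  next
    fix a assume "a \<in> T"
    then obtain n where "a \<in> C n" using two by blast
    then show "- a \<in> T" "inverse a \<in> T" using stepT[of _ n] unfolding step_def by blast+
    fix b assume "b \<in> T"
    then obtain n where n: "a \<in> C n" "b \<in> C n" using two \<open>a \<in> T\<close> by blast
    then have "(a, b) \<in> C n \<times> C n" by simp
    then have "(\<lambda>(a, b). a + b) (a, b) \<in> step (C n)" "(\<lambda>(a, b). a * b) (a, b) \<in> step (C n)"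
      unfolding step_def by blast+
    then show "a + b \<in> T" "a * b \<in> T" using stepT by auto
  qed
  have "x \<in> T" if alg: "algebraic_over T x" for x
  proof -
    obtain p where p: "p \<in> polys_over T" "p \<noteq> 0" "poly p x = 0"
      using alg algebraic_over_iff[OF sf] by blast
    have "poly.coeff p i \<in> T" for i using p(1) by (simp add: polys_over_def)
    then have "\<forall>i. \<exists>n. poly.coeff p i \<in> C n" unfolding T_def by simp
    then obtain N where N: "\<And>i. poly.coeff p i \<in> C (N i)" by metis
    define m where "m = Max (N ` {..Polynomial.degree p})"
    have "poly.coeff p i \<in> C m" for i
    proof (cases "i \<le> Polynomial.degree p")
      case True
      then have "N i \<le> m" unfolding m_def by simp
      then show ?thesis using N mono by blast
    next
      case False
      then show ?thesis using mono[of 0 m] by (auto simp: coeff_eq_0 C_def)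
    qed
    then have "p \<in> polys_over (C m)" by (simp add: polys_over_def)
    then have "x \<in> roots_over (C m)" using p(2,3) unfolding roots_over_def by blast
    then show ?thesis using stepT[of x m] unfolding step_def by blast
  qed
  then show ?thesis using sf base card unfolding relatively_closed_def T_def by blast
qed

lemma card_algebraic_closure_of:
  assumes "Cinfinite r" and "|S| \<le>o r"
  shows "|algebraic_closure_of S| \<le>o r"
proof -
  obtain T where "relatively_closed T" "S \<subseteq> T" "|T| \<le>o r"
    using exists_relatively_closed_superset[OF assms] by blast
  then show ?thesis
    using card_of_mono1[OF algebraic_closure_of_minimal] ordLeq_transitive by blast
qed

lemma card_algebraic_reals:
  assumes "Cinfinite r"
  shows "|- transcendental_reals| \<le>o r"
proof -
  have "- transcendental_reals \<subseteq> algebraic_closure_of {}"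
  proof
    fix x assume "x \<in> - transcendental_reals"
    then have "algebraic_over (generate_field real_field {}) x"
      by (simp add: transcendental_reals_def Rats_eq_generate_field)
    then show "x \<in> algebraic_closure_of {}"
      by (rule algebraic_over_generate_field_in_closed[OF relatively_closed_algebraic_closure_of empty_subsetI])
  qed
  moreover have "|algebraic_closure_of {}| \<le>o r"
    by (intro card_algebraic_closure_of assms finite_ordLeq_Cinfinite) simp
  ultimately show ?thesis using card_of_mono1 ordLeq_transitive by blast
qed

section \<open>Covering the transcendental reals when the continuum is small\<close>

lemma Max_wrt_well_order:
  assumes r: "Well_order r" and A: "finite A" "A \<noteq> {}" and f: "f ` A \<subseteq> Field r"
  shows "\<exists>x\<in>A. \<forall>y\<in>A. (f y, f x) \<in> r"
  using A f
proof (induction A rule: finite_ne_induct)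
  case (singleton x)
  interpret wo_rel r by (rule wo_rel.intro) (rule r)
  show ?case using REFL singleton by (auto simp: refl_on_def)
next
  case (insert x A)
  interpret wo_rel r by (rule wo_rel.intro) (rule r)
  obtain z where z: "z \<in> A" "\<forall>y\<in>A. (f y, f z) \<in> r" using insert by auto
  have xz: "f x \<in> Field r" "f z \<in> Field r" using insert.prems z(1) by auto
  then consider "(f x, f z) \<in> r" | "(f z, f x) \<in> r" using TOTALS by blast
  then show ?case
  proof cases
    case 1
    then show ?thesis using z by blast
  next
    case 2
    then have "(f y, f x) \<in> r" if "y \<in> A" for y using z(2) that TRANS unfolding trans_def by blast
    moreover have "(f x, f x) \<in> r" using REFL xz by (auto simp: refl_on_def)
    ultimately show ?thesis by blast
  qed
qed

text \<open>A well-order of the reals of type at most \<open>\<kappa>\<^sup>+\<close> yields an increasing chain of closed subfields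
  \<open>T\<^sub>a\<close> of size at most \<open>\<kappa>\<close>. The rank of a real is the first stage that contains it. Colouring the transcendental
  reals of each rank injectively with \<open>\<kappa>\<close> colours, distinct reals of the same colour have distinct ranks. In a
  finite set of one colour with at least two elements, the element of largest rank therefore lies
  outside a closed field containing all the others, which is what the independence criterion asks
  for; for a single element the criterion is just transcendence.\<close>

lemma transcendentals_cover_if_continuum_le:
  fixes \<kappa> :: "'k rel"
  assumes \<kappa>: "Cinfinite \<kappa>" and le: "|UNIV :: real set| \<le>o cardSuc \<kappa>"
  obtains A :: "'k \<Rightarrow> real set" where "\<And>i. algebraically_independent (A i)"
    and "transcendental_reals = (\<Union>i\<in>Field \<kappa>. A i)"
proof -
  let ?r = "cardSuc \<kappa>"
  have card_r: "Card_order ?r" using \<kappa> cardSuc_Card_order by blast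
  interpret wo_rel ?r
    using card_r card_order_on_well_order_on by (intro wo_rel.intro) blast
  have "|UNIV :: real set| \<le>o |Field ?r|"
    using le card_of_Field_ordIso[OF card_r] ordIso_symmetric ordLeq_ordIso_trans by blast
  then obtain f :: "real \<Rightarrow> _" where f: "inj f" "\<And>x. f x \<in> Field ?r"
    unfolding card_of_ordLeq[symmetric] by blast
  define T where "T a = algebraic_closure_of {z. (f z, a) \<in> ?r}" for a
  have T_mono: "T a \<subseteq> T b" if "(a, b) \<in> ?r" for a b
    unfolding T_def using that TRANS by (intro algebraic_closure_of_mono) (auto dest: transD)
  have closed: "relatively_closed (T a)" for a
    unfolding T_def by (rule relatively_closed_algebraic_closure_of)
  have card_T: "|T a| \<le>o \<kappa>" if a: "a \<in> Field ?r" for a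
    unfolding T_def
  proof (rule card_algebraic_closure_of[OF \<kappa>])
    have "|Order_Relation.underS ?r a| \<le>o \<kappa>"
      using card_of_underS[OF card_r a] cardSuc_ordLeq_ordLess[of \<kappa> "|Order_Relation.underS ?r a|"] \<kappa> 
        card_of_Card_order by blast
    then have "|insert a (Order_Relation.underS ?r a)| \<le>o \<kappa>"
      using Un_Cinfinite_bound[of "{a}" \<kappa> "Order_Relation.underS ?r a"] finite_ordLeq_Cinfinite[OF \<kappa>, of "{a}"] \<kappa>
      by simp
    moreover have "|{z. (f z, a) \<in> ?r}| \<le>o |insert a (Order_Relation.underS ?r a)|"
      using f(1) by (intro card_of_ordLeqI[of f]) (auto simp: Order_Relation.underS_def inj_on_def)
    ultimately show "|{z. (f z, a) \<in> ?r}| \<le>o \<kappa>" using ordLeq_transitive by blast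
  qed
  \<comment> \<open>One colouring of \<open>T\<^sub>a\<close> for each stage; it is used only on the reals of rank exactly \<open>a\<close>.\<close>
  have "\<exists>c. inj_on c (T a) \<and> c ` T a \<subseteq> Field \<kappa>" if "a \<in> Field ?r" for a
  proof -
    have "|T a| \<le>o |Field \<kappa>|"
      using card_T[OF that] card_of_Field_ordIso[of \<kappa>] \<kappa> ordIso_symmetric ordLeq_ordIso_trans by blast
    then show ?thesis unfolding card_of_ordLeq[symmetric] .
  qed
  then obtain c where c: "\<And>a. a \<in> Field ?r \<Longrightarrow> inj_on (c a) (T a)"
    "\<And>a. a \<in> Field ?r \<Longrightarrow> c a ` T a \<subseteq> Field \<kappa>" by metis
  define rank where "rank y = minim {a \<in> Field ?r. y \<in> T a}" for y
  have ex: "f y \<in> {a \<in> Field ?r. y \<in> T a}" for y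
    using f(2)[of y] REFL subset_algebraic_closure_of[of "{z. (f z, f y) \<in> ?r}"]
    by (auto simp: T_def refl_on_def)
  have rank: "rank y \<in> Field ?r" "y \<in> T (rank y)" for y
    using minim_in[of "{a \<in> Field ?r. y \<in> T a}"] ex[of y] unfolding rank_def by blast+
  have rank_least: "(rank y, a) \<in> ?r" if "a \<in> Field ?r" "y \<in> T a" for y a
    unfolding rank_def using that by (intro minim_least) auto
  define A where "A i = {y \<in> transcendental_reals. c (rank y) y = i}" for i
  show thesis
  proof
    show "transcendental_reals = (\<Union>i\<in>Field \<kappa>. A i)"
      using c(2)[OF rank(1)] rank(2) unfolding A_def by blast
    fix i
    have inj: "inj_on rank (A i)"
      using c(1)[OF rank(1)] rank(2) unfolding A_def inj_on_def by (metis (mono_tags, lifting) mem_Collect_eq)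
    have ranks: "rank ` B \<subseteq> Field ?r" for B using rank(1) by blast
    show "algebraically_independent (A i)"
    proof (rule algebraically_independentI)
      fix G assume G: "finite G" "G \<noteq> {}" "G \<subseteq> A i"
      obtain y where y: "y \<in> G" "\<forall>z\<in>G. (rank z, rank y) \<in> ?r"
        using Max_wrt_well_order[OF WELL G(1,2) ranks] by blast
      have "\<not> algebraic_over (generate_field real_field (G - {y})) y"
      proof (cases "G - {y} = {}")
        case True
        then show ?thesis
          using y(1) G(3) unfolding True
          by (auto simp: A_def transcendental_reals_def Rats_eq_generate_field)
      next
        case False
        \<comment> \<open>The stage of the second largest rank separates \<open>y\<close> from the other elements.\<close>
        then obtain w where w: "w \<in> G - {y}" "\<forall>z\<in>G - {y}. (rank z, rank w) \<in> ?r"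
          using Max_wrt_well_order[OF WELL _ False ranks] G(1) by blast
        have "G - {y} \<subseteq> T (rank w)" using w(2) rank(2) T_mono by blast
        moreover have "y \<notin> T (rank w)"
        proof
          assume "y \<in> T (rank w)"
          then have "(rank y, rank w) \<in> ?r" using rank_least rank(1) by blast
          moreover have "(rank w, rank y) \<in> ?r" using y(2) w(1) by blast
          ultimately have "rank w = rank y" using ANTISYM by (auto dest: antisymD)
          then show False using inj_onD[OF inj] w(1) y(1) G(3) by blast
        qed
        ultimately show ?thesis using algebraic_over_generate_field_in_closed[OF closed] by blast
      qed
      then show "\<exists>y\<in>G. \<not> algebraic_over (generate_field real_field (G - {y})) y" using y(1) by blast
    qed
  qed
qed

section \<open>No cover exists when the continuum is large\<close>

text \<open>The four sums satisfy \<open>(x\<^sub>1 + y\<^sub>1) + (x\<^sub>2 + y\<^sub>2) = (x\<^sub>1 + y\<^sub>2) + (x\<^sub>2 + y\<^sub>1)\<close>. Two opposite corners may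
  coincide, but not both pairs at once, so some corner differs from the other three and is a
  rational combination of them.\<close>

lemma no_sum_rectangle:
  assumes S: "algebraically_independent S" and ne: "x1 \<noteq> x2" "y1 \<noteq> y2"
  shows "\<not> {x1 + y1, x1 + y2, x2 + y1, x2 + y2} \<subseteq> S"
proof
  have dep: "\<not> {p, q, s, t} \<subseteq> S" if "p = s + t - q" "p \<notin> {q, s, t}" for p q s t
  proof
    assume sub: "{p, q, s, t} \<subseteq> S"
    let ?K = "generate_field real_field {q, s, t}"
    have "s \<in> ?K" "t \<in> ?K" "q \<in> ?K" by (auto intro: generate_field.incl)
    then have "s + t + - q \<in> ?K"
      using subfield_generate_field[of "{q, s, t}"] unfolding subfield_real_iff by blast
    then have "p \<in> ?K" using that(1) by simp
    then have "algebraic_over ?K p"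
      using domain.algebraic_self[OF domain_real_field subfieldE(1)[OF subfield_generate_field]] by blast
    then show False using algebraically_independentD[OF S, of "{q, s, t}" p] sub that(2) by simp
  qed
  assume sub: "{x1 + y1, x1 + y2, x2 + y1, x2 + y2} \<subseteq> S"
  show False
  proof (cases "x1 + y1 = x2 + y2")
    case False
    then show False using dep[of "x1 + y1" "x1 + y2" "x2 + y1" "x2 + y2"] sub ne by auto
  next
    case True
    then have "x1 + y2 \<noteq> x2 + y1" using ne by linarith
    then show False using dep[of "x1 + y2" "x1 + y1" "x2 + y2" "x2 + y1"] sub ne by auto
  qed
qed

text \<open>Fix \<open>\<kappa>\<^sup>+\<close> distinct reals \<open>g m\<close> and discard the at most \<open>\<kappa>\<^sup>+\<close> many reals \<open>y\<close> for which some \<open>g m + y\<close> is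
  algebraic. Each remaining \<open>y\<close> has \<open>m \<noteq> m'\<close> such that \<open>g m + y\<close> and \<open>g m' + y\<close> get the same one of the
  \<open>\<kappa>\<close> colours. There are only \<open>\<kappa>\<^sup>+\<close> triples of \<open>m\<close>, \<open>m'\<close> and a colour but more than \<open>\<kappa>\<^sup>+\<close> values of \<open>y\<close>,
  so two of them share a triple, and the resulting rectangle of sums has a single colour.\<close>

lemma continuum_le_if_transcendentals_cover:
  fixes \<kappa> :: "'k rel" and A :: "'k \<Rightarrow> real set"
  assumes \<kappa>: "Cinfinite \<kappa>" and indep: "\<And>i. i \<in> Field \<kappa> \<Longrightarrow> algebraically_independent (A i)"
    and cover: "transcendental_reals \<subseteq> (\<Union>i\<in>Field \<kappa>. A i)"
  shows "|UNIV :: real set| \<le>o cardSuc \<kappa>"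
proof (rule ccontr)
  let ?r = "cardSuc \<kappa>"
  assume not_le: "\<not> |UNIV :: real set| \<le>o ?r"
  have r: "Cinfinite ?r" using \<kappa> by (rule Cinfinite_cardSuc)
  have Field_r: "|Field ?r| =o ?r" using r card_of_Field_ordIso by blast
  have Field_\<kappa>: "|Field \<kappa>| =o \<kappa>" using \<kappa> card_of_Field_ordIso by blast
  have \<kappa>_le: "\<kappa> \<le>o ?r" using \<kappa> cardSuc_ordLeq by blast
  have "?r \<le>o |UNIV :: real set|"
    using not_le r card_of_Well_order ordLeq_total card_order_on_well_order_on by blast
  then have "|Field ?r| \<le>o |UNIV :: real set|" using Field_r ordIso_ordLeq_trans by blast
  then obtain g :: "_ \<Rightarrow> real" where g: "inj_on g (Field ?r)"
    unfolding card_of_ordLeq[symmetric] by blast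
  obtain col where col: "\<And>x. x \<in> transcendental_reals \<Longrightarrow> col x \<in> Field \<kappa>"
      "\<And>x. x \<in> transcendental_reals \<Longrightarrow> x \<in> A (col x)"
    using cover by (metis UN_E subsetD)
  define Bad where "Bad = (\<lambda>(a, m). a - g m) ` ((- transcendental_reals) \<times> Field ?r)"
  have card_Bad: "|Bad| \<le>o ?r"
    unfolding Bad_def using Field_r card_algebraic_reals[OF r] 
    by (intro image_ordLeq Times_ordLeq_Cinfinite r) (auto simp: ordIso_iff_ordLeq)
  have transc: "g m + y \<in> transcendental_reals" if "m \<in> Field ?r" "y \<notin> Bad" for m y
  proof (rule ccontr)
    assume "g m + y \<notin> transcendental_reals"
    then have "(\<lambda>(a, m). a - g m) (g m + y, m) \<in> Bad" using that(1) unfolding Bad_def by blast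
    then show False using that(2) by simp
  qed
  have "\<exists>m m'. m \<in> Field ?r \<and> m' \<in> Field ?r \<and> m \<noteq> m' \<and> col (g m + y) = col (g m' + y)"
    if y: "y \<notin> Bad" for y
  proof (rule ccontr)
    assume "\<not> ?thesis"
    then have "inj_on (\<lambda>m. col (g m + y)) (Field ?r)" unfolding inj_on_def by blast
    then have "|Field ?r| \<le>o |Field \<kappa>|" using col(1) transc y by (intro card_of_ordLeqI) auto
    then have "?r \<le>o \<kappa>" 
      using Field_r Field_\<kappa> ordIso_symmetric ordIso_ordLeq_trans ordLeq_ordIso_trans by blast
    moreover have "\<kappa> <o ?r" using \<kappa> cardSuc_greater by blast
    ultimately show False using not_ordLess_ordLeq by blast
  qed
  then obtain m m' where m: "\<And>y. y \<notin> Bad \<Longrightarrow> m y \<in> Field ?r" "\<And>y. y \<notin> Bad \<Longrightarrow> m' y \<in> Field ?r"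
    "\<And>y. y \<notin> Bad \<Longrightarrow> m y \<noteq> m' y" "\<And>y. y \<notin> Bad \<Longrightarrow> col (g (m y) + y) = col (g (m' y) + y)"
    by metis
  define h where "h y = (m y, m' y, col (g (m y) + y))" for y
  have "\<not> inj_on h (- Bad)"
  proof
    assume "inj_on h (- Bad)"
    then have "|- Bad| \<le>o |Field ?r \<times> Field ?r \<times> Field \<kappa>|"
      using m col(1) transc by (intro card_of_ordLeqI[of h]) (auto simp: h_def)
    moreover have "|Field ?r \<times> Field ?r \<times> Field \<kappa>| \<le>o ?r"
      using Field_r ordIso_ordLeq_trans[OF Field_\<kappa> \<kappa>_le]
      by (intro Times_ordLeq_Cinfinite r) (auto simp: ordIso_iff_ordLeq)
    ultimately have "|- Bad| \<le>o ?r" using ordLeq_transitive by blast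
    then have "|Bad \<union> - Bad| \<le>o ?r" using Un_Cinfinite_bound card_Bad r by blast
    then show False using not_le by simp
  qed
  then obtain y y' where y: "y \<notin> Bad" "y' \<notin> Bad" "y \<noteq> y'" "h y = h y'"
    unfolding inj_on_def by blast
  let ?i = "col (g (m y) + y)"
  have m_eq: "m y' = m y" "m' y' = m' y" "col (g (m y) + y') = ?i" using y(4) by (auto simp: h_def)
  have "{g (m y) + y, g (m y) + y', g (m' y) + y, g (m' y) + y'} \<subseteq> A ?i"
    using col(2) transc m y(1,2) m_eq by (metis empty_subsetI insert_subset)
  moreover have "g (m y) \<noteq> g (m' y)" using m y(1) inj_onD[OF g] by blast
  moreover have "algebraically_independent (A ?i)" using indep col(1) transc m(1) y(1) by blast
  ultimately show False using no_sum_rectangle[OF _ _ y(3)] by blast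
qed

section \<open>The equivalence\<close>

lemma continuum_card_of_reals: "ctwo ^c natLeq =o |UNIV :: real set|"
proof -
  have "ctwo ^c natLeq = |Func (UNIV :: nat set) (UNIV :: bool set)|"
    by (simp add: cexp_def ctwo_def Field_natLeq Field_card_of)
  moreover have "|UNIV :: nat set set| =o |Func (UNIV :: nat set) (UNIV :: bool set)|"
    using card_of_Pow_Func[of "UNIV :: nat set"] by simp
  moreover have "|UNIV :: nat set set| =o |UNIV :: real set|"
    using nat_sets_eqpoll_reals card_of_ordIsoI unfolding eqpoll_def by blast
  ultimately show ?thesis using ordIso_symmetric ordIso_transitive by metis
qed


theorem theorem4p2:
  fixes \<kappa> :: "'k rel"
  assumes "Card_order \<kappa>" and "cinfinite \<kappa>"
  shows "ctwo ^c natLeq \<le>o cardSuc \<kappa> \<longleftrightarrow>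
    (\<exists>A :: 'k \<Rightarrow> real set.
       (\<forall>i \<in> Field \<kappa>. algebraically_independent (A i)) \<and>
       transcendental_reals = (\<Union>i \<in> Field \<kappa>. A i))"
proof -
  have \<kappa>: "Cinfinite \<kappa>" using assms by (intro conjI)
  have continuum: "ctwo ^c natLeq \<le>o cardSuc \<kappa> \<longleftrightarrow> |UNIV :: real set| \<le>o cardSuc \<kappa>"
    using ordIso_ordLeq_trans[OF continuum_card_of_reals]
      ordIso_ordLeq_trans[OF ordIso_symmetric[OF continuum_card_of_reals]] by blast
  show ?thesis
    unfolding continuum
  proof
    assume "|UNIV :: real set| \<le>o cardSuc \<kappa>"
    then obtain A :: "'k \<Rightarrow> real set" where "\<And>i. algebraically_independent (A i)"
      and "transcendental_reals = (\<Union>i\<in>Field \<kappa>. A i)"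
      using transcendentals_cover_if_continuum_le[OF \<kappa>] by blast
    then show "\<exists>A :: 'k \<Rightarrow> real set. (\<forall>i \<in> Field \<kappa>. algebraically_independent (A i)) \<and>
       transcendental_reals = (\<Union>i \<in> Field \<kappa>. A i)"
      by blast
  next
    assume "\<exists>A :: 'k \<Rightarrow> real set. (\<forall>i \<in> Field \<kappa>. algebraically_independent (A i)) \<and>
       transcendental_reals = (\<Union>i \<in> Field \<kappa>. A i)"
    then show "|UNIV :: real set| \<le>o cardSuc \<kappa>"
      using continuum_le_if_transcendentals_cover[OF \<kappa>] by blast
  qed
qed

end
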